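(* For any layered graph $H$ and any natural number $n\ge 2$, $\chi_H(\mathbb{R}^n)=\chi(\mathbb{R}^n)$.
   Context: The hypercube $Q_d$ has vertex set $\{0,1\}^d$, two vertices being adjacent iff they differ in exactly one coordinate. The $i$-th vertex layer of $Q_d$ is the set of vertices with exactly $i$ ones; the $i$-th edge layer of $Q_d$ is the subgraph induced by the $i$-th and $(i+1)$-st vertex layers. A graph is layered if it is (isomorphic to) a subgraph of an edge layer of some hypercube. For a graph $F$, a copy of $F$ in $\mathbb{R}^n$ is a set of $|V(F)|$ points of $\mathbb{R}^n$ corresponding to the vertices of $F$ such that any two points of the set corresponding to two adjacent vertices of $F$ are at Euclidean distance $1$. $\chi_F(\mathbb{R}^n)$ is the smallest number of colors used on the points of $\mathbb{R}^n$ such that no copy of $F$ is monochromatic. $\chi(\mathbb{R}^n):=\chi_{K_2}(\mathbb{R}^n)$ is the chromatic number of the space $\mathbb{R}^n$.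
   Formalization: The layered graph H is assumed to have at least one edge; for an edgeless H no finite number of colors avoids a monochromatic copy, so the claim fails there. *)

theory Defs
  imports "HOL-Analysis.Analysis" "HOL-Library.Extended_Nat" "HOL-Library.FuncSet"
begin

type_synonym 'v ugraph = "'v set \<times> 'v set set"

abbreviation verts :: "'v ugraph \<Rightarrow> 'v set" where "verts \<equiv> fst"
abbreviation edges :: "'v ugraph \<Rightarrow> 'v set set" where "edges \<equiv> snd"

definition simple_graph :: "'v ugraph \<Rightarrow> bool" where
  "simple_graph G \<longleftrightarrow> finite (verts G) \<and> (\<forall>e\<in>edges G. e \<subseteq> verts G \<and> card e = 2)"

definition subgraph :: "'v ugraph \<Rightarrow> 'v ugraph \<Rightarrow> bool" where
  "subgraph G H \<longleftrightarrow> simple_graph G \<and> verts G \<subseteq> verts H \<and> edges G \<subseteq> edges H"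

definition induced_subgraph :: "'v ugraph \<Rightarrow> 'v set \<Rightarrow> 'v ugraph" where
  "induced_subgraph G W = (verts G \<inter> W, {e \<in> edges G. e \<subseteq> W})"

definition graph_iso :: "'v ugraph \<Rightarrow> 'w ugraph \<Rightarrow> bool" where
  "graph_iso G H \<longleftrightarrow> (\<exists>f. bij_betw f (verts G) (verts H) \<and>
     (\<forall>u\<in>verts G. \<forall>v\<in>verts G. {u, v} \<in> edges G \<longleftrightarrow> {f u, f v} \<in> edges H))"

definition complete_graph :: "nat \<Rightarrow> nat ugraph" where
  "complete_graph m = ({..<m}, {e. e \<subseteq> {..<m} \<and> card e = 2})"

text \<open>A vertex of the hypercube is an extensional function from the coordinates
  \<open>0, \<dots>, d - 1\<close> to \<open>{0, 1}\<close>.\<close>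

definition cube_verts :: "nat \<Rightarrow> (nat \<Rightarrow> nat) set" where
  "cube_verts d = {..<d} \<rightarrow>\<^sub>E {0, 1}"

definition hypercube :: "nat \<Rightarrow> (nat \<Rightarrow> nat) ugraph" where
  "hypercube d = (cube_verts d,
     {{x, y} | x y. x \<in> cube_verts d \<and> y \<in> cube_verts d \<and> card {j. j < d \<and> x j \<noteq> y j} = 1})"

definition vertex_layer :: "nat \<Rightarrow> nat \<Rightarrow> (nat \<Rightarrow> nat) set" where
  "vertex_layer d i = {x \<in> verts (hypercube d). card {j. j < d \<and> x j = 1} = i}"

definition edge_layer :: "nat \<Rightarrow> nat \<Rightarrow> (nat \<Rightarrow> nat) ugraph" where
  "edge_layer d i = induced_subgraph (hypercube d) (vertex_layer d i \<union> vertex_layer d (Suc i))"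

definition layered :: "'v ugraph \<Rightarrow> bool" where
  "layered H \<longleftrightarrow> (\<exists>d i G. i < d \<and> subgraph G (edge_layer d i) \<and> graph_iso H G)"

text \<open>A copy is not required to be induced: non-adjacent vertices may also be at distance 1.\<close>

definition is_copy :: "'v ugraph \<Rightarrow> (real ^ 'n) set \<Rightarrow> bool" where
  "is_copy F S \<longleftrightarrow> (\<exists>f. bij_betw f (verts F) S \<and>
     (\<forall>u v. {u, v} \<in> edges F \<longrightarrow> dist (f u) (f v) = 1))"

definition avoids_mono :: "'v ugraph \<Rightarrow> nat \<Rightarrow> (real ^ 'n \<Rightarrow> nat) \<Rightarrow> bool" where
  "avoids_mono F k c \<longleftrightarrow> range c \<subseteq> {..<k} \<and> (\<forall>S. is_copy F S \<longrightarrow> \<not> c constant_on S)"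

text \<open>The value is \<open>\<infinity>\<close> if no finite number of colors suffices.\<close>

definition chi_copy :: "'v ugraph \<Rightarrow> 'n::finite itself \<Rightarrow> enat" where
  "chi_copy F _ = Inf {enat k | k. \<exists>c :: real ^ 'n \<Rightarrow> nat. avoids_mono F k c}"

definition chi_space :: "'n::finite itself \<Rightarrow> enat" where
  "chi_space T = chi_copy (complete_graph 2) T"

end

theory Submission
  imports Defs
begin

text \<open>A proper coloring of the space has no monochromatic pair at distance \<open>1\<close>, hence no monochromatic
  copy of a graph with an edge. The content is the converse: if every coloring of \<open>\<real>\<^sup>n\<close> with \<open>k\<close> colors
  has a monochromatic pair at distance \<open>1\<close>, then every such coloring \<open>c\<close> has a monochromatic copy of
  every edge layer of every hypercube.

  Fix linear isometries \<open>\<theta>\<^sub>0, \<theta>\<^sub>1, \<dots>\<close> and send a word \<open>w\<close> over the alphabet \<open>\<real>\<^sup>n\<close> to the point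
  \<open>\<Sum>j. \<theta>\<^sub>j (w\<^sub>j)\<close>; then \<open>c\<close> becomes a coloring of words. If \<open>a\<close> and \<open>b\<close> are at distance \<open>1\<close>, replacing one
  letter \<open>a\<close> by \<open>b\<close> moves the point by a unit vector. So an edge layer of the \<open>d\<close>-cube appears as soon as
  there are contexts \<open>s\<^sub>0, \<dots>, s\<^sub>d\<close> such that \<open>s\<^sub>0 z\<^sub>1 s\<^sub>1 z\<^sub>2 \<dots> z\<^sub>d s\<^sub>d\<close> has one and the same color for all
  choices of letters \<open>z\<^sub>j\<close> in \<open>{a, b}\<close> with \<open>i\<close> or \<open>i + 1\<close> letters \<open>b\<close>.

  If the color of a word depended only on its image in a finite group, such contexts would be easy to
  find: if the context in front of each letter \<open>z\<close> has the value \<open>a\<inverse>\<close>, then each site contributes \<open>1\<close> or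
  \<open>g = a\<inverse>b\<close>, and the product only sees the number of letters \<open>b\<close>; with an additional factor \<open>a g\<^sup>-\<^sup>i\<close>
  in front of everything, the two layers have the values \<open>a\<close> and \<open>a g = b\<close>. The letters are the points of
  \<open>\<real>\<^sup>n\<close>, so by hypothesis \<open>a\<close> and \<open>b\<close> can be chosen at distance \<open>1\<close> and of the same color.

  For an arbitrary coloring the group comes from topological dynamics. Words act on colorings by shifts,
  and the pointwise limits of shifts form a compact right topological semigroup. By the theorem of Ellis
  such a semigroup has an idempotent \<open>e\<close> in a minimal left ideal, and the elements of the form \<open>e x e\<close>
  are then a group with unit \<open>e\<close> (\<open>minimal_idempotent_exists\<close>, \<open>minimal_idempotent_group_translation\<close>). The
  group elements \<open>e v e\<close>, for \<open>v\<close> a point, play the role of the letters. Since each limit agrees with an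
  actual word on any finite set of arguments, the contexts given by group elements can be replaced one
  after the other by words (\<open>words_along_layers\<close>).

  The copy has to have distinct points. For this the isometries are chosen such that no nonzero vector
  is sent to the same vector by infinitely many of them, and the letters \<open>z\<^sub>j\<close> are placed late enough in
  the word that each new unit vector avoids the finitely many differences of the earlier subset sums.
  This is where \<open>n \<ge> 2\<close> enters.\<close>

section \<open>Minimal idempotents in compact right topological semigroups\<close>

text \<open>Zorn's lemma, turned upside down: both ideals and subsemigroups will be taken minimal.\<close>

lemma minimal_set_of_chain_closed_family:
  assumes ne: "F \<noteq> {}"
    and chain: "\<And>C. \<lbrakk>C \<noteq> {}; C \<subseteq> F; \<And>A B. A \<in> C \<Longrightarrow> B \<in> C \<Longrightarrow> A \<subseteq> B \<or> B \<subseteq> A\<rbrakk> \<Longrightarrow> \<Inter>C \<in> F"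
  obtains M where "M \<in> F" "\<And>A. A \<in> F \<Longrightarrow> A \<subseteq> M \<Longrightarrow> A = M"
proof -
  have po: "partial_order_on F (relation_of (\<lambda>A B. B \<subseteq> A) F)"
    unfolding partial_order_on_def preorder_on_def refl_on_def trans_def antisym_def relation_of_def
    by auto
  have "\<exists>m\<in>F. \<forall>a\<in>F. a \<subseteq> m \<longrightarrow> a = m"
  proof (rule predicate_Zorn[OF po])
    fix C assume C: "C \<in> Chains (relation_of (\<lambda>A B. B \<subseteq> A) F)"
    then have sub: "C \<subseteq> F" and "\<And>A B. A \<in> C \<Longrightarrow> B \<in> C \<Longrightarrow> A \<subseteq> B \<or> B \<subseteq> A"
      unfolding Chains_def relation_of_def by blast+
    then have "C \<noteq> {} \<Longrightarrow> \<Inter>C \<in> F"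
      using chain by simp
    with ne show "\<exists>u\<in>F. \<forall>a\<in>C. u \<subseteq> a"
      by blast
  qed
  with that show thesis by blast
qed

lemma compact_space_chain_Inter_nonempty:
  assumes "compact_space X" "C \<noteq> {}"
    and closed: "\<And>A. A \<in> C \<Longrightarrow> closedin X A \<and> A \<noteq> {}"
    and chain: "\<And>A B. A \<in> C \<Longrightarrow> B \<in> C \<Longrightarrow> A \<subseteq> B \<or> B \<subseteq> A"
  shows "\<Inter>C \<noteq> {}"
proof -
  have "\<Inter>D \<in> C" if "finite D" "D \<noteq> {}" "D \<subseteq> C" for D
    using that
  proof (induction D rule: finite_ne_induct)
    case (insert A D)
    then have "\<Inter>(insert A D) = A \<or> \<Inter>(insert A D) = \<Inter>D"
      using chain[of A "\<Inter>D"] by auto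
    then show ?case using insert by auto
  qed auto
  then have "\<Inter>D \<noteq> {}" if "finite D" "D \<subseteq> C" for D
    using closed that by (cases "D = {}") auto
  with closed show ?thesis
    using assms(1)[unfolded compact_space_fip, THEN spec, of C] by simp
qed

text \<open>Only the right multiplications \<open>x \<mapsto> x \<cdot> y\<close> are continuous: composition of functions, with the
  topology of pointwise convergence, is continuous in its first argument but not in the second.\<close>

locale compact_right_topological_semigroup =
  fixes X :: "'a topology" and mul :: "'a \<Rightarrow> 'a \<Rightarrow> 'a" (infixl "\<cdot>" 70)
  assumes compact: "compact_space X"
    and Hausdorff: "Hausdorff_space X"
    and nonempty: "topspace X \<noteq> {}"
    and assoc: "(x \<cdot> y) \<cdot> z = x \<cdot> (y \<cdot> z)"
    and right_continuous: "y \<in> topspace X \<Longrightarrow> continuous_map X X (\<lambda>x. x \<cdot> y)"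
begin

lemma mul_closed: "x \<in> topspace X \<Longrightarrow> y \<in> topspace X \<Longrightarrow> x \<cdot> y \<in> topspace X"
  using right_continuous continuous_map_image_subset_topspace by fastforce

lemma closedin_mul_right:
  assumes "closedin X A" "y \<in> topspace X"
  shows "closedin X ((\<lambda>x. x \<cdot> y) ` A)"
  using assms compact Hausdorff right_continuous
  by (meson closedin_compact_space compactin_imp_closedin image_compactin)

definition closed_subsemigroup :: "'a set \<Rightarrow> bool" where
  "closed_subsemigroup K \<longleftrightarrow> closedin X K \<and> K \<noteq> {} \<and> (\<forall>x\<in>K. \<forall>y\<in>K. x \<cdot> y \<in> K)"

definition closed_left_ideal :: "'a set \<Rightarrow> bool" where
  "closed_left_ideal L \<longleftrightarrow> closedin X L \<and> L \<noteq> {} \<and> (\<forall>x\<in>topspace X. \<forall>y\<in>L. x \<cdot> y \<in> L)"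

text \<open>A minimal closed subsemigroup consists of idempotents (Ellis, Numakura): for \<open>x\<close> in it, minimality gives
  \<open>K \<cdot> x = K\<close>, so \<open>x\<close> has left units in \<open>K\<close>; these form a closed subsemigroup, again all of \<open>K\<close>, so that \<open>x\<close>
  is a left unit of itself.\<close>

lemma idempotent_exists:
  assumes S: "closed_subsemigroup S"
  obtains e where "e \<in> S" "e \<cdot> e = e"
proof -
  obtain K where K: "closed_subsemigroup K" "K \<subseteq> S"
    and Kmin: "\<And>A. closed_subsemigroup A \<Longrightarrow> A \<subseteq> K \<Longrightarrow> A = K"
  proof (rule minimal_set_of_chain_closed_family[of "{K. closed_subsemigroup K \<and> K \<subseteq> S}"])
    fix C assume C: "C \<noteq> {}" "C \<subseteq> {K. closed_subsemigroup K \<and> K \<subseteq> S}"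
      "\<And>A B. A \<in> C \<Longrightarrow> B \<in> C \<Longrightarrow> A \<subseteq> B \<or> B \<subseteq> A"
    have "\<Inter>C \<noteq> {}"
      using C by (intro compact_space_chain_Inter_nonempty[OF compact])
        (auto simp: closed_subsemigroup_def)
    moreover have "closedin X (\<Inter>C)"
      using C by (intro closedin_Inter) (auto simp: closed_subsemigroup_def)
    ultimately show "\<Inter>C \<in> {K. closed_subsemigroup K \<and> K \<subseteq> S}"
      using C unfolding closed_subsemigroup_def by blast
  qed (use S in auto)
  obtain x where x: "x \<in> K"
    using K by (auto simp: closed_subsemigroup_def)
  have sub: "K \<subseteq> topspace X"
    using K closedin_subset by (auto simp: closed_subsemigroup_def)
  have "closed_subsemigroup ((\<lambda>y. y \<cdot> x) ` K)"
    using K x sub closedin_mul_right[of K x]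
    by (auto simp: closed_subsemigroup_def assoc[symmetric])
  moreover have "(\<lambda>y. y \<cdot> x) ` K \<subseteq> K"
    using K x by (auto simp: closed_subsemigroup_def)
  ultimately have "(\<lambda>y. y \<cdot> x) ` K = K"
    by (rule Kmin)
  with x obtain y where y: "y \<in> K" "y \<cdot> x = x"
    by (metis imageE)
  have "closedin X {y \<in> topspace X. y \<cdot> x \<in> {x}}"
    using right_continuous[of x] x sub Hausdorff
    by (intro closedin_continuous_map_preimage) (auto simp: closedin_Hausdorff_singleton)
  then have "closedin X (K \<inter> {y \<in> topspace X. y \<cdot> x \<in> {x}})"
    using K by (auto simp: closed_subsemigroup_def)
  moreover have "K \<inter> {y \<in> topspace X. y \<cdot> x \<in> {x}} = {y \<in> K. y \<cdot> x = x}"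
    using sub by auto
  ultimately have "closed_subsemigroup {y \<in> K. y \<cdot> x = x}"
    using K y by (auto simp: closed_subsemigroup_def assoc)
  then have "x \<cdot> x = x"
    using Kmin[of "{y \<in> K. y \<cdot> x = x}"] x by blast
  with x K that show thesis by blast
qed

text \<open>The last property says that \<open>e\<close> generates a minimal left ideal: from every element of that ideal one can
  return to \<open>e\<close> by a left multiplication. All use of minimality below goes through it.\<close>

lemma minimal_idempotent_exists:
  obtains e where "e \<in> topspace X" "e \<cdot> e = e"
    "\<And>a. a \<in> topspace X \<Longrightarrow> \<exists>h\<in>topspace X. h \<cdot> (a \<cdot> e) = e"
proof -
  obtain L where L: "closed_left_ideal L"
    and Lmin: "\<And>A. closed_left_ideal A \<Longrightarrow> A \<subseteq> L \<Longrightarrow> A = L"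
  proof (rule minimal_set_of_chain_closed_family[of "Collect closed_left_ideal"])
    show "Collect closed_left_ideal \<noteq> {}"
      using nonempty mul_closed by (auto simp: closed_left_ideal_def intro!: exI[of _ "topspace X"])
    fix C assume C: "C \<noteq> {}" "C \<subseteq> Collect closed_left_ideal"
      "\<And>A B. A \<in> C \<Longrightarrow> B \<in> C \<Longrightarrow> A \<subseteq> B \<or> B \<subseteq> A"
    have "\<Inter>C \<noteq> {}"
      using C by (intro compact_space_chain_Inter_nonempty[OF compact])
        (auto simp: closed_left_ideal_def)
    moreover have "closedin X (\<Inter>C)"
      using C by (intro closedin_Inter) (auto simp: closed_left_ideal_def)
    ultimately show "\<Inter>C \<in> Collect closed_left_ideal"
      using C unfolding closed_left_ideal_def by blast
  qed auto
  have sub: "L \<subseteq> topspace X"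
    using L closedin_subset by (auto simp: closed_left_ideal_def)
  then have "closed_subsemigroup L"
    using L by (auto simp: closed_left_ideal_def closed_subsemigroup_def)
  then obtain e where e: "e \<in> L" "e \<cdot> e = e"
    using idempotent_exists by blast
  have "\<exists>h\<in>topspace X. h \<cdot> (a \<cdot> e) = e" if a: "a \<in> topspace X" for a
  proof -
    have ae: "a \<cdot> e \<in> L"
      using L a e by (auto simp: closed_left_ideal_def)
    have "closed_left_ideal ((\<lambda>x. x \<cdot> (a \<cdot> e)) ` topspace X)"
      using ae sub nonempty mul_closed closedin_mul_right[of "topspace X" "a \<cdot> e"]
      by (auto simp: closed_left_ideal_def assoc[symmetric])
    moreover have "(\<lambda>x. x \<cdot> (a \<cdot> e)) ` topspace X \<subseteq> L"
      using L ae by (auto simp: closed_left_ideal_def)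
    ultimately have "(\<lambda>x. x \<cdot> (a \<cdot> e)) ` topspace X = L"
      by (rule Lmin)
    then show ?thesis
      using e(1) by force
  qed
  with e sub that show thesis by blast
qed

text \<open>In the group of the elements \<open>e \<cdot> x \<cdot> e\<close>, the element \<open>h\<close> is the inverse of \<open>e \<cdot> s \<cdot> e\<close> and \<open>\<rho> m\<close> is the
  \<open>m\<close>-th power of \<open>g = h \<cdot> t \<cdot> e\<close>. Hence putting \<open>h\<close> and \<open>s\<close> in front of a power of \<open>g\<close> changes nothing, while
  putting \<open>h\<close> and \<open>t\<close> in front of it counts one up: a product of such factors depends only on how often
  \<open>t\<close> occurs. The element \<open>y\<close> shifts the origin of the counting, so that the exponents \<open>i\<close> and \<open>i + 1\<close>
  give the values that belong to \<open>s\<close> and \<open>t\<close>.\<close>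

lemma minimal_idempotent_group_translation:
  assumes e: "e \<in> topspace X" "e \<cdot> e = e"
    and minimal: "\<And>a. a \<in> topspace X \<Longrightarrow> \<exists>h\<in>topspace X. h \<cdot> (a \<cdot> e) = e"
    and st: "s \<in> topspace X" "t \<in> topspace X"
  obtains h y and \<rho> :: "nat \<Rightarrow> 'a"
  where "h \<in> topspace X" "h \<cdot> e = h" "y \<in> topspace X"
    "\<And>m. \<rho> m \<in> topspace X" "\<rho> 0 = e"
    "\<And>m. h \<cdot> (s \<cdot> \<rho> m) = \<rho> m" "\<And>m. h \<cdot> (t \<cdot> \<rho> m) = \<rho> (Suc m)"
    "y \<cdot> \<rho> i = e \<cdot> (s \<cdot> e)" "y \<cdot> \<rho> (Suc i) = e \<cdot> (t \<cdot> e)"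
proof -
  note [simp] = mul_closed e
  have ee: "e \<cdot> (e \<cdot> x) = e \<cdot> x" for x
    by (simp flip: assoc)
  define \<gamma> where "\<gamma> = e \<cdot> (s \<cdot> e)"
  have \<gamma>: "\<gamma> \<in> topspace X" "e \<cdot> \<gamma> = \<gamma>" "\<gamma> \<cdot> e = \<gamma>"
    using st by (simp_all add: \<gamma>_def assoc ee)
  obtain h0 where h0: "h0 \<in> topspace X" "h0 \<cdot> \<gamma> = e"
    using minimal[OF \<gamma>(1)] \<gamma>(3) by auto
  define h where "h = e \<cdot> (h0 \<cdot> e)"
  have h: "h \<in> topspace X" "e \<cdot> h = h" "h \<cdot> e = h"
    using h0 by (simp_all add: h_def assoc ee)
  have h\<gamma>: "h \<cdot> \<gamma> = e"
    using h0 \<gamma> by (simp add: h_def assoc)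
  \<comment> \<open>A left inverse is also a right inverse, since \<open>e\<close> is the only idempotent of the group.\<close>
  have \<gamma>h: "\<gamma> \<cdot> h = e"
  proof -
    have idem: "(\<gamma> \<cdot> h) \<cdot> (\<gamma> \<cdot> h) = \<gamma> \<cdot> h"
      by (metis assoc h\<gamma> \<gamma>(3))
    obtain z where "z \<cdot> (\<gamma> \<cdot> h) = e"
      using minimal[of "\<gamma> \<cdot> h"] \<gamma> h by (auto simp: assoc)
    then show ?thesis
      by (metis idem assoc \<gamma>(2))
  qed
  define \<rho> where "\<rho> = rec_nat e (\<lambda>_ r. h \<cdot> (t \<cdot> r))"
  have \<rho>0: "\<rho> 0 = e" and \<rho>Suc: "\<rho> (Suc m) = h \<cdot> (t \<cdot> \<rho> m)" for m
    by (simp_all add: \<rho>_def)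
  have \<rho>: "\<rho> m \<in> topspace X" "e \<cdot> \<rho> m = \<rho> m" "\<rho> m \<cdot> e = \<rho> m" for m
    using st h by (induction m) (simp_all add: \<rho>0 \<rho>Suc assoc flip: assoc[of e h])
  have s\<rho>: "h \<cdot> (s \<cdot> \<rho> m) = \<rho> m" for m
  proof -
    have "h \<cdot> (s \<cdot> \<rho> m) = (h \<cdot> e) \<cdot> (s \<cdot> (e \<cdot> \<rho> m))"
      by (simp add: \<rho> h)
    also have "\<dots> = (h \<cdot> \<gamma>) \<cdot> \<rho> m"
      by (simp add: \<gamma>_def assoc)
    finally show ?thesis
      by (simp add: h\<gamma> \<rho>)
  qed
  have comm: "\<rho> (Suc m) = \<rho> m \<cdot> \<rho> 1" for m
  proof (induction m)
    case 0
    show ?case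
      using \<rho>(2)[of 1] by (simp add: \<rho>0)
  next
    case (Suc m)
    have "\<rho> (Suc (Suc m)) = h \<cdot> (t \<cdot> (\<rho> m \<cdot> \<rho> 1))"
      by (simp only: \<rho>Suc[of "Suc m"] Suc.IH)
    also have "\<dots> = \<rho> (Suc m) \<cdot> \<rho> 1"
      by (simp only: \<rho>Suc[of m] assoc)
    finally show ?case .
  qed
  obtain z where z: "z \<in> topspace X" "z \<cdot> \<rho> i = e"
    using minimal[OF \<rho>(1)[of i]] \<rho>(3) by auto
  have y: "(\<gamma> \<cdot> z) \<cdot> \<rho> i = \<gamma>"
    by (simp add: assoc z \<gamma>)
  have "(\<gamma> \<cdot> z) \<cdot> \<rho> (Suc i) = ((\<gamma> \<cdot> z) \<cdot> \<rho> i) \<cdot> \<rho> 1"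
    by (simp only: comm[of i] assoc)
  also have "\<dots> = (\<gamma> \<cdot> h) \<cdot> (t \<cdot> e)"
    unfolding y using \<rho>Suc[of 0] by (simp add: \<rho>0 assoc)
  also have "\<dots> = e \<cdot> (t \<cdot> e)"
    by (simp only: \<gamma>h)
  finally have y': "(\<gamma> \<cdot> z) \<cdot> \<rho> (Suc i) = e \<cdot> (t \<cdot> e)" .
  show thesis
    by (rule that[of h "\<gamma> \<cdot> z" \<rho>])
      (use h \<gamma> z \<rho> \<rho>0 s\<rho> \<rho>Suc y y' in \<open>simp_all flip: \<gamma>_def\<close>)
qed

end

section \<open>Isometries without persistent coincidences\<close>

text \<open>On the moment curve \<open>(1, m, m\<^sup>2, \<dots>)\<close> the inner product with a fixed \<open>v \<noteq> 0\<close> is a nonzero polynomial in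
  \<open>m\<close>.\<close>

lemma moment_curve_finitely_many_orthogonal:
  obtains q :: "nat \<Rightarrow> 'a::euclidean_space"
  where "\<And>v. v \<noteq> 0 \<Longrightarrow> finite {m. q m \<bullet> v = 0}"
proof -
  let ?D = "DIM('a)"
  obtain f :: "nat \<Rightarrow> 'a" where f: "bij_betw f {0..<?D} Basis"
    using ex_bij_betw_nat_finite[OF finite_Basis] by blast
  define q :: "nat \<Rightarrow> 'a" where "q m = (\<Sum>i=0..<?D. real m ^ i *\<^sub>R f i)" for m
  have "finite {m. q m \<bullet> v = 0}" if "v \<noteq> 0" for v
  proof -
    define c where "c i = (if i < ?D then f i \<bullet> v else 0)" for i
    obtain b where b: "b \<in> Basis" "b \<bullet> v \<noteq> 0"
      using \<open>v \<noteq> 0\<close> by (metis euclidean_all_zero_iff inner_commute)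
    from f b(1) obtain i where "i \<in> {0..<?D}" and bi: "b = f i"
      by (metis bij_betw_imp_surj_on imageE)
    then have i: "i < ?D"
      by simp
    have "finite {x. (\<Sum>i\<le>?D. c i * x ^ i) = 0}"
      using b bi i by (intro polyfun_roots_finite[of c i]) (auto simp: c_def)
    then have "finite (real -` {x. (\<Sum>i\<le>?D. c i * x ^ i) = 0})"
      by (intro finite_vimageI) (auto simp: inj_on_def)
    moreover have "(\<Sum>i\<le>?D. c i * real m ^ i) = q m \<bullet> v" for m
    proof -
      have "(\<Sum>i\<le>?D. c i * real m ^ i) = (\<Sum>i=0..<?D. c i * real m ^ i)"
        by (intro sum.mono_neutral_right) (auto simp: c_def)
      also have "\<dots> = q m \<bullet> v"
        by (auto simp: q_def inner_sum_left c_def intro!: sum.cong)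
      finally show ?thesis .
    qed
    ultimately show ?thesis
      by (simp add: vimage_def)
  qed
  with that show thesis by blast
qed

text \<open>The isometries are the reflections along the points \<open>q m\<close> of the moment curve. If one of them fixes \<open>v\<close>,
  then \<open>q m\<close> is orthogonal to \<open>v\<close>. If it sends \<open>v\<close> to \<open>p \<noteq> v\<close>, then \<open>q m\<close> is parallel to \<open>v - p\<close>, hence
  orthogonal to some fixed \<open>z \<noteq> 0\<close> that is orthogonal to \<open>v - p\<close>, which exists in dimension at least \<open>2\<close>. In
  dimension at least \<open>3\<close>, rotations in a single plane would not do: they fix the vectors orthogonal to
  that plane.\<close>

lemma isometries_taking_values_finitely_often:
  assumes dim: "2 \<le> DIM('a::euclidean_space)"
  obtains \<theta> :: "nat \<Rightarrow> 'a::euclidean_space \<Rightarrow> 'a"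
  where "\<And>m. linear (\<theta> m)" "\<And>m v. norm (\<theta> m v) = norm v"
    "\<And>v p. v \<noteq> 0 \<Longrightarrow> finite {m. \<theta> m v = p}"
proof -
  obtain q :: "nat \<Rightarrow> 'a" where q: "\<And>v. v \<noteq> 0 \<Longrightarrow> finite {m. q m \<bullet> v = 0}"
    using moment_curve_finitely_many_orthogonal by blast
  define \<theta> where "\<theta> m v = v - (2 * (q m \<bullet> v) / (q m \<bullet> q m)) *\<^sub>R q m" for m v
  have "linear (\<theta> m)" for m
    by (rule linearI) (simp_all add: \<theta>_def inner_right_distrib scaleR_add_left algebra_simps add_divide_distrib)
  moreover have "norm (\<theta> m v) = norm v" for m v
  proof (cases "q m = 0")
    case False
    then have "\<theta> m v \<bullet> \<theta> m v = v \<bullet> v"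
      by (simp add: \<theta>_def inner_diff_left inner_diff_right inner_commute field_simps)
    then show ?thesis
      by (simp add: norm_eq_sqrt_inner)
  qed (simp add: \<theta>_def)
  moreover have "finite {m. \<theta> m v = p}" if v: "v \<noteq> 0" for v p
  proof (cases "p = v")
    case True
    have "{m. \<theta> m v = p} \<subseteq> {m. q m \<bullet> v = 0}"
      using True by (auto simp: \<theta>_def)
    with q[OF v] show ?thesis
      by (rule rev_finite_subset)
  next
    case False
    obtain z where z: "z \<noteq> 0" "orthogonal (v - p) z"
      using orthogonal_to_vector_exists[OF dim] by blast
    have "q m \<bullet> z = 0" if "\<theta> m v = p" for m
    proof -
      define t where "t = 2 * (q m \<bullet> v) / (q m \<bullet> q m)"
      have "v - p = t *\<^sub>R q m"
        using that by (auto simp: \<theta>_def t_def)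
      with z(2) False show ?thesis
        by (auto simp: orthogonal_def)
    qed
    then have "{m. \<theta> m v = p} \<subseteq> {m. q m \<bullet> z = 0}"
      by blast
    with q[OF z(1)] show ?thesis
      by (rule rev_finite_subset)
  qed
  ultimately show thesis
    using that by blast
qed

section \<open>The semigroup of limits of shifts\<close>

definition colorings :: "nat \<Rightarrow> ('s list \<Rightarrow> nat) set" where
  "colorings k = {x. \<forall>u. x u < k}"

text \<open>Only colorings with the colors \<open>0, \<dots>, k - 1\<close> are shifted, the other ones are left alone: unbounded
  colorings would destroy the compactness of the set of limits below.\<close>

definition shift :: "nat \<Rightarrow> 's list \<Rightarrow> ('s list \<Rightarrow> nat) \<Rightarrow> 's list \<Rightarrow> nat" where
  "shift k w x = (if x \<in> colorings k then \<lambda>u. x (u @ w) else x)"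

text \<open>The closure of the set of all shifts in the topology of pointwise convergence, spelled out as
  agreement with a shift on every finite set of arguments.\<close>

definition shift_limits :: "nat \<Rightarrow> (('s list \<Rightarrow> nat) \<Rightarrow> 's list \<Rightarrow> nat) set" where
  "shift_limits k = {p. (\<forall>x. x \<notin> colorings k \<longrightarrow> p x = x) \<and>
     (\<forall>F. finite F \<longrightarrow> F \<subseteq> colorings k \<times> UNIV \<longrightarrow> (\<exists>w. \<forall>(x, u)\<in>F. p x u = x (u @ w)))}"

lemma shift_limits_approx:
  assumes "p \<in> shift_limits k" "finite F" "F \<subseteq> colorings k \<times> UNIV"
  obtains w where "\<And>x u. (x, u) \<in> F \<Longrightarrow> p x u = x (u @ w)"
proof -
  have "\<exists>w. \<forall>(x, u)\<in>F. p x u = x (u @ w)"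
    using assms by (simp add: shift_limits_def)
  then obtain w where "\<forall>(x, u)\<in>F. p x u = x (u @ w)" ..
  then show thesis
    by (intro that[of w]) auto
qed

lemma shift_limits_colorings:
  assumes "p \<in> shift_limits k" "x \<in> colorings k"
  shows "p x \<in> colorings k"
proof -
  have "p x u < k" for u
  proof -
    have "{(x, u)} \<subseteq> colorings k \<times> UNIV"
      using assms(2) by simp
    then obtain w where "\<And>x' u'. (x', u') \<in> {(x, u)} \<Longrightarrow> p x' u' = x' (u' @ w)"
      by (rule shift_limits_approx[OF assms(1) finite.insertI[OF finite.emptyI]]) (rule that)
    then have "p x u = x (u @ w)"
      by simp
    with assms(2) show ?thesis
      by (simp add: colorings_def)
  qed
  then show ?thesis
    by (simp add: colorings_def)
qed

lemma shift_in_shift_limits: "shift k (w0 :: 's list) \<in> shift_limits k"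
  unfolding shift_limits_def
proof (intro CollectI conjI allI impI)
  fix F :: "(('s list \<Rightarrow> nat) \<times> 's list) set"
  assume "F \<subseteq> colorings k \<times> UNIV"
  then show "\<exists>w. \<forall>(x, u)\<in>F. shift k w0 x u = x (u @ w)"
    by (intro exI[of _ w0]) (auto simp: shift_def)
qed (simp add: shift_def)

text \<open>Words are found for the outer factor first, because the arguments at which the inner factor has to be
  approximated are those displaced by that word.\<close>

lemma shift_limits_comp:
  assumes p: "p \<in> shift_limits k" and q: "q \<in> shift_limits k"
  shows "p \<circ> q \<in> shift_limits k"
proof -
  have "\<exists>w. \<forall>(x, u)\<in>F. (p \<circ> q) x u = x (u @ w)"
    if F: "finite F" "F \<subseteq> colorings k \<times> UNIV" for F
  proof -
    let ?F1 = "(\<lambda>(x, u). (q x, u)) ` F"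
    have "finite ?F1" "?F1 \<subseteq> colorings k \<times> UNIV"
      using F shift_limits_colorings[OF q] by auto
    then obtain v where v: "\<And>x u. (x, u) \<in> ?F1 \<Longrightarrow> p x u = x (u @ v)"
      by (rule shift_limits_approx[OF p]) (rule that)
    let ?F2 = "(\<lambda>(x, u). (x, u @ v)) ` F"
    have "finite ?F2" "?F2 \<subseteq> colorings k \<times> UNIV"
      using F by auto
    then obtain w where w: "\<And>x u. (x, u) \<in> ?F2 \<Longrightarrow> q x u = x (u @ w)"
      by (rule shift_limits_approx[OF q]) (rule that)
    have "(p \<circ> q) x u = x (u @ (v @ w))" if "(x, u) \<in> F" for x u
    proof -
      have "p (q x) u = q x (u @ v)"
        using that by (intro v) (rule rev_image_eqI, auto)
      also have "\<dots> = x ((u @ v) @ w)"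
        using that by (intro w) (rule rev_image_eqI, auto)
      finally show ?thesis
        by simp
    qed
    then show ?thesis
      by (intro exI[of _ "v @ w"]) auto
  qed
  moreover have "(p \<circ> q) x = x" if "x \<notin> colorings k" for x
    using that p q by (simp add: shift_limits_def)
  ultimately show ?thesis
    by (simp add: shift_limits_def)
qed

lemma closed_shift_limits: "closed (shift_limits k :: (('s list \<Rightarrow> nat) \<Rightarrow> 's list \<Rightarrow> nat) set)"
proof -
  let ?E = "shift_limits k :: (('s list \<Rightarrow> nat) \<Rightarrow> 's list \<Rightarrow> nat) set"
  have eval: "open {p::('s list \<Rightarrow> nat) \<Rightarrow> 's list \<Rightarrow> nat. p x u = n}" for x u n
  proof -
    have "continuous_on UNIV (\<lambda>p::('s list \<Rightarrow> nat) \<Rightarrow> 's list \<Rightarrow> nat. p x u)"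
      by (rule continuous_on_product_then_coordinatewise[OF continuous_on_product_coordinates])
    then have "open ((\<lambda>p::('s list \<Rightarrow> nat) \<Rightarrow> 's list \<Rightarrow> nat. p x u) -` {n})"
      by (intro open_vimage open_discrete)
    then show ?thesis
      by (simp add: vimage_def)
  qed
  have "\<exists>U. open U \<and> p \<in> U \<and> U \<subseteq> - ?E" if "p \<notin> ?E" for p
  proof -
    show ?thesis
    proof (cases "\<forall>x. x \<notin> colorings k \<longrightarrow> p x = x")
      case False
      then obtain x u where "x \<notin> colorings k" "p x u \<noteq> x u"
        by (auto simp: fun_eq_iff)
      then have "{p'. p' x u = p x u} \<subseteq> - ?E"
        by (auto simp: shift_limits_def)
      with eval show ?thesis
        by blast
    next
      case True
      then obtain F where approx: "finite F" "F \<subseteq> colorings k \<times> UNIV"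
          "\<not> (\<exists>w. \<forall>(x, u)\<in>F. p x u = x (u @ w))"
        using \<open>p \<notin> ?E\<close> by (auto simp: shift_limits_def)
      have "open (\<Inter>(x, u)\<in>F. {p'. p' x u = p x u})"
        using approx(1) eval by (intro open_INT) auto
      moreover have "(\<Inter>(x, u)\<in>F. {p'. p' x u = p x u}) \<subseteq> - ?E"
      proof
        fix p' assume p': "p' \<in> (\<Inter>(x, u)\<in>F. {p'. p' x u = p x u})"
        show "p' \<in> - ?E"
        proof
          assume "p' \<in> ?E"
          then obtain w where "\<And>x u. (x, u) \<in> F \<Longrightarrow> p' x u = x (u @ w)"
            using approx(1,2) by (rule shift_limits_approx) (rule that)
          with p' have "\<forall>(x, u)\<in>F. p x u = x (u @ w)"
            by auto
          with approx(3) show False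
            by blast
        qed
      qed
      ultimately show ?thesis
        by blast
    qed
  qed
  then have "open (- ?E)"
    by (subst open_subopen) blast
  then show ?thesis
    by (simp add: closed_def)
qed

text \<open>A closed subset of a product of finite sets of colors: a shift takes bounded colorings to bounded ones
  and fixes the others.\<close>

lemma compact_shift_limits: "compact (shift_limits k :: (('s list \<Rightarrow> nat) \<Rightarrow> 's list \<Rightarrow> nat) set)"
proof -
  let ?V = "\<lambda>x::'s list \<Rightarrow> nat. \<lambda>u. if x \<in> colorings k then {..<k} else {x u}"
  let ?B = "Pi\<^sub>E UNIV (\<lambda>x. Pi\<^sub>E UNIV (?V x))"
  have inner: "compactin euclidean (Pi\<^sub>E UNIV (?V x))" for x
    by (subst euclidean_product_topology[symmetric])
      (auto simp: compactin_PiE intro: finite_imp_compact)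
  have "compactin euclidean ?B"
    by (subst euclidean_product_topology[symmetric])
      (use inner in \<open>auto simp: compactin_PiE\<close>)
  then have "compact ?B"
    by simp
  moreover have "shift_limits k \<subseteq> ?B"
    using shift_limits_colorings by (auto simp: colorings_def shift_limits_def PiE_def Pi_def)
  then have "?B \<inter> shift_limits k = shift_limits k"
    by (rule inf.absorb2)
  ultimately show ?thesis
    using compact_Int_closed[OF _ closed_shift_limits, of ?B k] by simp
qed

lemma Hausdorff_space_euclidean_t2: "Hausdorff_space (euclidean :: 'b::t2_space topology)"
  using hausdorff unfolding Hausdorff_space_def disjnt_def by fastforce

lemma Hausdorff_space_euclidean_fun:
  assumes "Hausdorff_space (euclidean :: 'b::topological_space topology)"
  shows "Hausdorff_space (euclidean :: ('a \<Rightarrow> 'b) topology)"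
  using assms by (subst euclidean_product_topology[symmetric]) (simp add: Hausdorff_space_product_topology)

lemma compact_right_topological_semigroup_shift_limits:
  "compact_right_topological_semigroup
     (top_of_set (shift_limits k :: (('s list \<Rightarrow> nat) \<Rightarrow> 's list \<Rightarrow> nat) set)) (\<circ>)"
proof
  let ?E = "shift_limits k :: (('s list \<Rightarrow> nat) \<Rightarrow> 's list \<Rightarrow> nat) set"
  show "compact_space (top_of_set ?E)"
    by (intro compact_space_subtopology) (simp add: compact_shift_limits)
  show "Hausdorff_space (top_of_set ?E)"
    by (intro Hausdorff_space_subtopology Hausdorff_space_euclidean_fun Hausdorff_space_euclidean_t2)
  show "topspace (top_of_set ?E) \<noteq> {}"
    using shift_in_shift_limits by auto
  show "(x \<circ> y) \<circ> z = x \<circ> (y \<circ> z)" for x y z :: "('s list \<Rightarrow> nat) \<Rightarrow> 's list \<Rightarrow> nat"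
    by (rule comp_assoc)
  fix q assume "q \<in> topspace (top_of_set ?E)"
  then have q: "q \<in> ?E"
    by simp
  have "continuous_on ?E (\<lambda>p. p \<circ> q)"
    unfolding comp_def
    by (rule continuous_on_coordinatewise_then_product,
        rule continuous_on_subset[OF continuous_on_product_coordinates subset_UNIV])
  then show "continuous_map (top_of_set ?E) (top_of_set ?E) (\<lambda>p. p \<circ> q)"
    by (auto intro: shift_limits_comp[OF _ q])
qed

section \<open>Monochromatic edge layers\<close>

text \<open>Any long word \<open>d\<close> can be hidden in \<open>e\<close>: minimality returns from \<open>d e\<close> to \<open>e\<close>, so \<open>p = p e = p h d e\<close>, and
  approximating \<open>p h\<close> and \<open>e\<close> separately leaves \<open>d\<close> in the middle of the resulting word.\<close>

lemma shift_limits_long_approx: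
  fixes e :: "('s list \<Rightarrow> nat) \<Rightarrow> 's list \<Rightarrow> nat"
  assumes e: "e \<in> shift_limits k"
    and minimal: "\<forall>a\<in>shift_limits k. \<exists>h\<in>shift_limits k. h \<circ> (a \<circ> e) = e"
    and p: "p \<in> shift_limits k" "p \<circ> e = p"
    and F: "finite F" "F \<subseteq> colorings k \<times> UNIV"
  obtains w where "N \<le> length w" "\<And>x u. (x, u) \<in> F \<Longrightarrow> p x u = x (u @ w)"
proof -
  define d :: "'s list" where "d = replicate N undefined"
  obtain h where h: "h \<in> shift_limits k" "h \<circ> (shift k d \<circ> e) = e"
    using minimal shift_in_shift_limits by blast
  have p_eq: "p x = (p \<circ> h) (shift k d (e x))" for x
    by (metis comp_apply h(2) p(2))
  have ecol: "e x \<in> colorings k" if "x \<in> colorings k" for x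
    using shift_limits_colorings[OF e that] .
  let ?F1 = "(\<lambda>(x, u). (shift k d (e x), u)) ` F"
  have "?F1 \<subseteq> colorings k \<times> UNIV"
    using F(2) ecol shift_limits_colorings[OF shift_in_shift_limits[of k d]] by auto
  then obtain v where v: "\<And>x u. (x, u) \<in> ?F1 \<Longrightarrow> (p \<circ> h) x u = x (u @ v)"
    by (rule shift_limits_approx[OF shift_limits_comp[OF p(1) h(1)] finite_imageI[OF F(1)]]) (rule that)
  let ?F2 = "(\<lambda>(x, u). (x, u @ v @ d)) ` F"
  have "?F2 \<subseteq> colorings k \<times> UNIV"
    using F(2) by auto
  then obtain w where w: "\<And>x u. (x, u) \<in> ?F2 \<Longrightarrow> e x u = x (u @ w)"
    by (rule shift_limits_approx[OF e finite_imageI[OF F(1)]]) (rule that)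
  have "p x u = x (u @ (v @ d @ w))" if "(x, u) \<in> F" for x u
  proof -
    have "p x u = (p \<circ> h) (shift k d (e x)) u"
      by (rule fun_cong[OF p_eq])
    also have "\<dots> = shift k d (e x) (u @ v)"
      by (intro v) (rule rev_image_eqI[OF that], simp)
    also have "\<dots> = e x (u @ v @ d)"
      using that F(2) ecol by (auto simp: shift_def)
    also have "\<dots> = x ((u @ v @ d) @ w)"
      by (intro w) (rule rev_image_eqI[OF that], simp)
    finally show ?thesis
      by simp
  qed
  then show thesis
    by (intro that[of "v @ d @ w"]) (auto simp: d_def)
qed

definition word_point :: "(nat \<Rightarrow> 'a \<Rightarrow> 'a::real_normed_vector) \<Rightarrow> 'a list \<Rightarrow> 'a" where
  "word_point \<theta> w = (\<Sum>j<length w. \<theta> j (w ! j))"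

lemma word_point_snoc: "word_point \<theta> (w @ [z]) = word_point \<theta> w + \<theta> (length w) z"
  by (simp add: word_point_def nth_append)

lemma word_point_append:
  "word_point \<theta> (u @ w) = word_point \<theta> u + (\<Sum>j<length w. \<theta> (length u + j) (w ! j))"
proof (induction w rule: rev_induct)
  case (snoc z w)
  show ?case
    using word_point_snoc[of \<theta> "u @ w" z] snoc by (simp add: nth_append)
qed simp

text \<open>The element \<open>h\<close> in front of the \<open>j\<close>-th letter is replaced by a word, for \<open>j = 0, 1, \<dots>\<close> in turn. After \<open>j\<close>
  steps there is, for every choice \<open>A\<close> of the sites that carry the letter \<open>b\<close>, a word \<open>W A\<close>, and what
  remains to the right of it is a power \<open>\<rho> m\<close>, where \<open>m\<close> is the number of letters \<open>b\<close> still to come. The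
  last conjunct says that the color obtained depends only on the total number of letters \<open>b\<close>. At most
  \<open>d\<close> letters are considered, in order that only finitely many arguments have to be approximated.\<close>

lemma words_along_layers:
  fixes \<theta> :: "nat \<Rightarrow> 'a::real_normed_vector \<Rightarrow> 'a" and \<rho> :: "nat \<Rightarrow> ('a list \<Rightarrow> nat) \<Rightarrow> 'a list \<Rightarrow> nat"
  assumes lin: "\<And>m. linear (\<theta> m)" and iso: "\<And>m v. norm (\<theta> m v) = norm v"
    and finite_fibres: "\<And>v p. v \<noteq> 0 \<Longrightarrow> finite {m. \<theta> m v = p}"
    and ab: "norm (b - a) = 1"
    and e: "e \<in> shift_limits k"
    and minimal: "\<forall>a\<in>shift_limits k. \<exists>h\<in>shift_limits k. h \<circ> (a \<circ> e) = e"
    and h: "h \<in> shift_limits k" "h \<circ> e = h"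
    and y: "y \<in> shift_limits k"
    and \<rho>: "\<And>m. \<rho> m \<in> shift_limits k"
    and ha: "\<And>m. h \<circ> (shift k [a] \<circ> \<rho> m) = \<rho> m"
    and hb: "\<And>m. h \<circ> (shift k [b] \<circ> \<rho> m) = \<rho> (Suc m)"
    and x: "x \<in> colorings k"
    and "j \<le> d"
  shows "\<exists>l W P u. (\<forall>A\<subseteq>{..<j}. length (W A) = l \<and> word_point \<theta> (W A) = P + sum u A) \<and>
     (\<forall>i<j. norm (u i) = 1) \<and> inj_on (sum u) (Pow {..<j}) \<and>
     (\<forall>A\<subseteq>{..<j}. \<forall>m. j + m \<le> d \<longrightarrow> \<rho> m x (W A) = y (\<rho> (card A + m) x) [])"
  using \<open>j \<le> d\<close>
proof (induction j)
  case 0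
  have \<rho>x: "\<rho> m x \<in> colorings k" for m
    using shift_limits_colorings[OF \<rho> x] .
  have "finite ((\<lambda>m. (\<rho> m x, [])) ` {..d})" "(\<lambda>m. (\<rho> m x, [])) ` {..d} \<subseteq> colorings k \<times> UNIV"
    using \<rho>x by auto
  then obtain w where w: "\<And>z u. (z, u) \<in> (\<lambda>m. (\<rho> m x, [])) ` {..d} \<Longrightarrow> y z u = z (u @ w)"
    by (rule shift_limits_approx[OF y]) (rule that)
  have "\<rho> m x w = y (\<rho> m x) []" if "m \<le> d" for m
    using w[of "\<rho> m x" "[]"] that by simp
  then show ?case
    by (intro exI[of _ "length w"] exI[of _ "\<lambda>_. w"] exI[of _ "word_point \<theta> w"] exI[of _ "\<lambda>_. 0"])
      auto
next
  case (Suc j)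
  have \<rho>x: "\<rho> m x \<in> colorings k" for m
    using shift_limits_colorings[OF \<rho> x] .
  from Suc.IH[OF Suc_leD[OF Suc.prems]] obtain l W P u where
      W0: "\<forall>A\<subseteq>{..<j}. length (W A) = l \<and> word_point \<theta> (W A) = P + sum u A"
    and u0: "\<forall>i<j. norm (u i) = 1" and u_inj: "inj_on (sum u) (Pow {..<j})"
    and col0: "\<forall>A\<subseteq>{..<j}. \<forall>m. j + m \<le> d \<longrightarrow> \<rho> m x (W A) = y (\<rho> (card A + m) x) []"
    by (elim exE conjE) (rule that)
  have W: "length (W A) = l" "word_point \<theta> (W A) = P + sum u A" if "A \<subseteq> {..<j}" for A
    using W0 that by simp_all
  have col: "\<rho> m x (W A) = y (\<rho> (card A + m) x) []" if "A \<subseteq> {..<j}" "j + m \<le> d" for A m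
    using col0 that by simp
  \<comment> \<open>A unit vector outside \<open>D\<close> keeps the subset sums distinct, and \<open>\<theta> m (b - a)\<close> is one for all late sites \<open>m\<close>.\<close>
  define D where "D = (\<lambda>(A, B). sum u A - sum u B) ` (Pow {..<j} \<times> Pow {..<j})"
  have "b - a \<noteq> 0"
    using ab by force
  then have "finite (\<Union>p\<in>D. {m. \<theta> m (b - a) = p})"
    by (intro finite_UN_I finite_fibres) (simp add: D_def)
  then obtain N where "\<And>m. m \<in> (\<Union>p\<in>D. {m. \<theta> m (b - a) = p}) \<Longrightarrow> m < N"
    by (metis finite_nat_bounded lessThan_iff subsetD)
  then have N: "\<theta> m (b - a) \<notin> D" if "N \<le> m" for m
    using that by force
  define F where "F = (\<lambda>(z, m, A). (shift k [z] (\<rho> m x), W A)) ` ({a, b} \<times> {..d} \<times> Pow {..<j})"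
  have "finite F"
    by (simp add: F_def)
  moreover have "F \<subseteq> colorings k \<times> UNIV"
    using shift_limits_colorings[OF shift_in_shift_limits \<rho>x] by (auto simp: F_def)
  ultimately obtain w where w: "N \<le> length w" "\<And>z v. (z, v) \<in> F \<Longrightarrow> h z v = z (v @ w)"
    by (rule shift_limits_long_approx[OF e minimal h]) (rule that)
  have hw: "h (shift k [z] (\<rho> m x)) (W A) = \<rho> m x (W A @ w @ [z])"
    if "z \<in> {a, b}" "m \<le> d" "A \<subseteq> {..<j}" for z m A
  proof -
    have "h (shift k [z] (\<rho> m x)) (W A) = shift k [z] (\<rho> m x) (W A @ w)"
      unfolding F_def by (intro w(2)[unfolded F_def] rev_image_eqI[of "(z, m, A)"]) (use that in auto)
    then show ?thesis
      using \<rho>x by (simp add: shift_def)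
  qed
  define W' where "W' A = W (A - {j}) @ w @ [if j \<in> A then b else a]" for A
  define u' where "u' = u(j := \<theta> (l + length w) (b - a))"
  define P' where "P' = P + (\<Sum>i<length w. \<theta> (l + i) (w ! i)) + \<theta> (l + length w) a"
  have sum_u': "sum u' A = sum u (A - {j}) + (if j \<in> A then \<theta> (l + length w) (b - a) else 0)"
    if "A \<subseteq> {..<Suc j}" for A
  proof -
    have fin: "finite A"
      using that finite_subset by blast
    have "sum u' (A - {j}) = sum u (A - {j})"
      by (intro sum.cong) (auto simp: u'_def)
    then show ?thesis
      using fin by (cases "j \<in> A") (auto simp: sum.remove u'_def)
  qed
  have minus: "A - {j} \<subseteq> {..<j}" if "A \<subseteq> {..<Suc j}" for A
    using that by (auto simp: less_Suc_eq)
  have points: "length (W' A) = l + length w + 1 \<and> word_point \<theta> (W' A) = P' + sum u' A"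
    if A: "A \<subseteq> {..<Suc j}" for A
  proof -
    have "word_point \<theta> (W' A) = word_point \<theta> (W (A - {j}) @ w) + \<theta> (l + length w) (if j \<in> A then b else a)"
      using word_point_snoc[of \<theta> "W (A - {j}) @ w"] W(1)[OF minus[OF A]] by (simp add: W'_def)
    then show ?thesis
      using W[OF minus[OF A]]
      by (auto simp: W'_def word_point_append P'_def sum_u'[OF A] linear_diff[OF lin])
  qed
  have norms: "norm (u' i) = 1" if "i < Suc j" for i
    using that u0 ab iso by (auto simp: u'_def less_Suc_eq)
  have inj: "inj_on (sum u') (Pow {..<Suc j})"
  proof (rule inj_onI)
    fix A B assume A: "A \<in> Pow {..<Suc j}" and B: "B \<in> Pow {..<Suc j}" and eq: "sum u' A = sum u' B"
    let ?t = "\<theta> (l + length w) (b - a)"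
    have "?t \<notin> D"
      using N w(1) by simp
    moreover have "sum u A' - sum u B' \<in> D" if "A' \<subseteq> {..<j}" "B' \<subseteq> {..<j}" for A' B'
      unfolding D_def by (rule image_eqI[of _ _ "(A', B')"]) (use that in auto)
    ultimately have ne: "?t \<noteq> sum u (A - {j}) - sum u (B - {j})" "?t \<noteq> sum u (B - {j}) - sum u (A - {j})"
      using minus A B by (metis PowD)+
    have eq': "sum u (A - {j}) + (if j \<in> A then ?t else 0) = sum u (B - {j}) + (if j \<in> B then ?t else 0)"
      using eq sum_u' A B by simp
    have iff: "j \<in> A \<longleftrightarrow> j \<in> B"
      using eq' ne by (auto simp: algebra_simps split: if_splits)
    then have "sum u (A - {j}) = sum u (B - {j})"
      using eq' by (auto split: if_splits)
    then have "A - {j} = B - {j}"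
      using u_inj minus A B by (auto simp: inj_on_def)
    with iff show "A = B"
      by blast
  qed
  have cols: "\<rho> m x (W' A) = y (\<rho> (card A + m) x) []"
    if A: "A \<subseteq> {..<Suc j}" and m: "Suc j + m \<le> d" for A m
  proof (cases "j \<in> A")
    case True
    have "finite A"
      using A finite_subset by blast
    then have card: "card A = Suc (card (A - {j}))"
      using True by (rule card.remove)
    have "\<rho> m x (W' A) = h (shift k [b] (\<rho> m x)) (W (A - {j}))"
      using hw[of b m "A - {j}"] minus[OF A] m True by (simp add: W'_def)
    also have "\<dots> = \<rho> (Suc m) x (W (A - {j}))"
      by (metis hb comp_apply)
    also have "\<dots> = y (\<rho> (card A + m) x) []"
      using col[OF minus[OF A], of "Suc m"] m card by simp
    finally show ?thesis .
  next
    case False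
    have "\<rho> m x (W' A) = h (shift k [a] (\<rho> m x)) (W (A - {j}))"
      using hw[of a m "A - {j}"] minus[OF A] m False by (simp add: W'_def)
    also have "\<dots> = \<rho> m x (W (A - {j}))"
      by (metis ha comp_apply)
    also have "\<dots> = y (\<rho> (card A + m) x) []"
      using col[OF minus[OF A], of m] m False by simp
    finally show ?thesis .
  qed
  show ?case
    using points norms inj cols
    by (intro exI[of _ "l + length w + 1"] exI[of _ W'] exI[of _ P'] exI[of _ u']) blast
qed

text \<open>The color of the group element \<open>\<gamma> v\<close> defines a new coloring of the space, in the variable \<open>v\<close>. The pair
  \<open>a\<close>, \<open>b\<close> that the hypothesis yields for this new coloring determines the letters on the sites. The
  number \<open>i\<close> of the layer only enters through the choice of the first factor \<open>y\<close>.\<close>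

theorem monochromatic_edge_layer:
  fixes c :: "'a::euclidean_space \<Rightarrow> nat" and d i :: nat
  assumes dim: "2 \<le> DIM('a)" and c: "\<And>p. c p < k"
    and unit_pair: "\<forall>f :: 'a \<Rightarrow> nat. (\<forall>p. f p < k) \<longrightarrow> (\<exists>a b. dist a b = 1 \<and> f a = f b)"
  obtains P :: 'a and u :: "nat \<Rightarrow> 'a" and \<kappa> :: nat where "\<And>j. j < d \<Longrightarrow> norm (u j) = 1" "inj_on (sum u) (Pow {..<d})"
    "\<And>A. A \<subseteq> {..<d} \<Longrightarrow> card A \<in> {i, Suc i} \<Longrightarrow> c (P + sum u A) = \<kappa>"
proof -
  let ?E = "shift_limits k :: (('a list \<Rightarrow> nat) \<Rightarrow> 'a list \<Rightarrow> nat) set"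
  interpret E: compact_right_topological_semigroup "top_of_set ?E" "(\<circ>)"
    by (rule compact_right_topological_semigroup_shift_limits)
  obtain \<theta> :: "nat \<Rightarrow> 'a \<Rightarrow> 'a" where \<theta>: "\<And>m. linear (\<theta> m)" "\<And>m v. norm (\<theta> m v) = norm v"
    "\<And>v p. v \<noteq> 0 \<Longrightarrow> finite {m. \<theta> m v = p}"
    using isometries_taking_values_finitely_often[OF dim] by blast
  obtain e where e: "e \<in> ?E" "e \<circ> e = e" "\<And>a. a \<in> ?E \<Longrightarrow> \<exists>h\<in>?E. h \<circ> (a \<circ> e) = e"
    using E.minimal_idempotent_exists by auto
  define x where "x = c \<circ> word_point \<theta>"
  have x: "x \<in> colorings k"
    using c by (simp add: x_def colorings_def)
  define \<gamma> where "\<gamma> v = e \<circ> (shift k [v] \<circ> e)" for v :: 'a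
  have "\<gamma> v \<in> ?E" for v
    unfolding \<gamma>_def by (intro shift_limits_comp e(1) shift_in_shift_limits)
  then have "\<gamma> v x [] < k" for v
    using shift_limits_colorings[OF _ x] by (auto simp: colorings_def)
  then obtain a b where ab: "dist a b = 1" "\<gamma> a x [] = \<gamma> b x []"
    using unit_pair[THEN spec, of "\<lambda>v. \<gamma> v x []"] by blast
  obtain h y \<rho> where h: "h \<in> ?E" "h \<circ> e = h" and y: "y \<in> ?E"
    and \<rho>: "\<And>m. \<rho> m \<in> ?E" "\<rho> 0 = e"
      "\<And>m. h \<circ> (shift k [a] \<circ> \<rho> m) = \<rho> m" "\<And>m. h \<circ> (shift k [b] \<circ> \<rho> m) = \<rho> (Suc m)"
    and y\<rho>: "y \<circ> \<rho> i = \<gamma> a" "y \<circ> \<rho> (Suc i) = \<gamma> b"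
    using E.minimal_idempotent_group_translation[of e "shift k [a]" "shift k [b]" i] e shift_in_shift_limits
    unfolding \<gamma>_def by (metis topspace_euclidean_subtopology)
  have "norm (b - a) = 1"
    using ab(1) by (simp add: dist_norm norm_minus_commute)
  then have "\<exists>l W P u. (\<forall>A\<subseteq>{..<d}. length (W A) = l \<and> word_point \<theta> (W A) = P + sum u A) \<and>
     (\<forall>i<d. norm (u i) = 1) \<and> inj_on (sum u) (Pow {..<d}) \<and>
     (\<forall>A\<subseteq>{..<d}. \<forall>m. d + m \<le> d \<longrightarrow> \<rho> m x (W A) = y (\<rho> (card A + m) x) [])"
    by (intro words_along_layers[where \<theta> = \<theta> and a = a and b = b and e = e and h = h and y = y and \<rho> = \<rho> and x = x and k = k] ballI) (rule \<theta> e h y \<rho> x order_refl | assumption)+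
  then obtain l W P u where
      W0: "\<forall>A\<subseteq>{..<d}. length (W A) = l \<and> word_point \<theta> (W A) = P + sum u A"
    and u: "\<forall>i<d. norm (u i) = 1" "inj_on (sum u) (Pow {..<d})"
    and col: "\<forall>A\<subseteq>{..<d}. \<forall>m. d + m \<le> d \<longrightarrow> \<rho> m x (W A) = y (\<rho> (card A + m) x) []"
    by (elim exE conjE) (rule that)
  have W: "length (W A) = l" "word_point \<theta> (W A) = P + sum u A" if "A \<subseteq> {..<d}" for A
    using W0 that by simp_all
  \<comment> \<open>To the right of the last site there is still the factor \<open>\<rho> 0 = e\<close>; it becomes the word \<open>w\<close>.\<close>
  have "finite ((\<lambda>A. (x, W A)) ` Pow {..<d})" "(\<lambda>A. (x, W A)) ` Pow {..<d} \<subseteq> colorings k \<times> UNIV"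
    using x by auto
  then obtain w where w: "\<And>z v. (z, v) \<in> (\<lambda>A. (x, W A)) ` Pow {..<d} \<Longrightarrow> e z v = z (v @ w)"
    by (rule shift_limits_approx[OF e(1)]) (rule that)
  define P' where "P' = P + (\<Sum>j<length w. \<theta> (l + j) (w ! j))"
  have y\<rho>x: "y (\<rho> i x) [] = \<gamma> a x []" "y (\<rho> (Suc i) x) [] = \<gamma> a x []"
    using y\<rho> ab(2) by (metis comp_apply)+
  have "c (P' + sum u A) = \<gamma> a x []" if A: "A \<subseteq> {..<d}" "card A \<in> {i, Suc i}" for A
  proof -
    have "c (P' + sum u A) = x (W A @ w)"
      using W A by (simp add: x_def word_point_append P'_def algebra_simps)
    also have "\<dots> = e x (W A)"
      by (intro w[symmetric] rev_image_eqI[of A]) (use A in auto)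
    also have "\<dots> = y (\<rho> (card A) x) []"
      using col A(1) \<rho>(2) by simp
    also have "\<dots> = \<gamma> a x []"
      using A(2) y\<rho>x by auto
    finally show ?thesis .
  qed
  with u show thesis
    by (intro that[of u P' "\<gamma> a x []"]) simp_all
qed

section \<open>Layered graphs\<close>

lemma dist_subset_sums_eq_1:
  fixes P :: "'a::real_normed_vector" and d :: nat
  assumes u: "\<And>j. j < d \<Longrightarrow> norm (u j) = 1"
    and AB: "A \<subseteq> {..<d}" "B \<subseteq> {..<d}" and card: "card ((A - B) \<union> (B - A)) = 1"
  shows "dist (P + sum u A) (P + sum u B) = 1"
proof -
  have fin: "finite A" "finite B"
    using AB by (auto intro: finite_subset)
  obtain j where j: "(A - B) \<union> (B - A) = {j}"
    using card by (rule card_1_singletonE) (rule that)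
  then have sub: "A - B \<subseteq> {j}" "B - A \<subseteq> {j}" and mem: "j \<in> A \<and> j \<notin> B \<or> j \<in> B \<and> j \<notin> A"
    by auto
  then have "j < d"
    using AB by auto
  from mem show ?thesis
  proof
    assume "j \<in> A \<and> j \<notin> B"
    then have "j \<notin> B" "A = insert j B"
      using sub by auto
    then show ?thesis
      using fin u[OF \<open>j < d\<close>] by (simp add: dist_norm)
  next
    assume "j \<in> B \<and> j \<notin> A"
    then have "j \<notin> A" "B = insert j A"
      using sub by auto
    then show ?thesis
      using fin u[OF \<open>j < d\<close>] by (simp add: dist_norm)
  qed
qed

text \<open>A vertex of the cube goes to the subset sum over its support. Distances between points that are not
  adjacent in \<open>H\<close> are arbitrary, so it is enough to treat the whole edge layer.\<close>

lemma monochromatic_layered_copy: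
  fixes H :: "'v ugraph" and c :: "real ^ 'n::finite \<Rightarrow> nat"
  assumes H: "simple_graph H" "layered H" and dim: "CARD('n) \<ge> 2"
    and c: "\<And>p. c p < k"
    and unit_pair: "\<forall>f :: real ^ 'n \<Rightarrow> nat. (\<forall>p. f p < k) \<longrightarrow> (\<exists>a b. dist a b = 1 \<and> f a = f b)"
  obtains S where "is_copy H S" "c constant_on S"
proof -
  obtain d i G where G: "subgraph G (edge_layer d i)" "graph_iso H G"
    using H(2) unfolding layered_def by blast
  obtain f where f: "bij_betw f (verts H) (verts G)"
    and f_edge: "\<And>u v. u \<in> verts H \<Longrightarrow> v \<in> verts H \<Longrightarrow> {u, v} \<in> edges H \<longleftrightarrow> {f u, f v} \<in> edges G"
    using G(2) unfolding graph_iso_def by blast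
  have "2 \<le> DIM(real ^ 'n)"
    using dim by simp
  then obtain P :: "real ^ 'n" and u \<kappa> where u: "\<And>j. j < d \<Longrightarrow> norm (u j) = 1"
    and inj: "inj_on (sum u) (Pow {..<d})"
    and mono: "\<And>A. A \<subseteq> {..<d} \<Longrightarrow> card A \<in> {i, Suc i} \<Longrightarrow> c (P + sum u A) = \<kappa>"
    by (rule monochromatic_edge_layer[OF _ c unit_pair, of d i]) (rule that)
  define supp where "supp x = {j. j < d \<and> x j = 1}" for x :: "nat \<Rightarrow> nat"
  have supp: "supp x \<subseteq> {..<d}" for x
    by (auto simp: supp_def)
  have supp_inj: "inj_on supp (cube_verts d)"
  proof (rule inj_onI)
    fix x y assume xy: "x \<in> cube_verts d" "y \<in> cube_verts d" and eq: "supp x = supp y"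
    show "x = y"
    proof (rule PiE_ext[OF xy[unfolded cube_verts_def]])
      fix j assume "j \<in> {..<d}"
      moreover have "x j \<in> {0, 1}" "y j \<in> {0, 1}"
        using xy \<open>j \<in> {..<d}\<close> by (auto simp: cube_verts_def)
      moreover have "j \<in> supp x \<longleftrightarrow> j \<in> supp y"
        using eq by simp
      ultimately show "x j = y j"
        by (auto simp: supp_def)
    qed
  qed
  define \<phi> where "\<phi> v = P + sum u (supp (f v))" for v
  have layer: "f v \<in> cube_verts d \<and> card (supp (f v)) \<in> {i, Suc i}" if "v \<in> verts H" for v
  proof -
    have "f v \<in> verts (edge_layer d i)"
      using f G(1) that by (auto simp: bij_betw_def subgraph_def)
    then show ?thesis
      by (auto simp: edge_layer_def induced_subgraph_def vertex_layer_def hypercube_def supp_def)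
  qed
  have "inj_on \<phi> (verts H)"
  proof (rule inj_onI)
    fix v w assume v: "v \<in> verts H" and w: "w \<in> verts H" and "\<phi> v = \<phi> w"
    then have "supp (f v) = supp (f w)"
      using inj supp by (simp add: \<phi>_def inj_on_def)
    then have "f v = f w"
      using supp_inj layer v w by (auto dest: inj_onD)
    then show "v = w"
      using f v w by (auto simp: bij_betw_def dest: inj_onD)
  qed
  then have "bij_betw \<phi> (verts H) (\<phi> ` verts H)"
    by (rule inj_on_imp_bij_betw)
  moreover have "dist (\<phi> v) (\<phi> w) = 1" if vw: "{v, w} \<in> edges H" for v w
  proof -
    have in_H: "v \<in> verts H" "w \<in> verts H"
      using H(1) vw by (auto simp: simple_graph_def)
    then have "{f v, f w} \<in> edges (edge_layer d i)"
      using f_edge vw G(1) by (auto simp: subgraph_def)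
    then obtain x y where xy: "{f v, f w} = {x, y}" "card {j. j < d \<and> x j \<noteq> y j} = 1"
      by (auto simp: edge_layer_def induced_subgraph_def hypercube_def)
    have "card {j. j < d \<and> f v j \<noteq> f w j} = 1"
      using xy by (auto simp: doubleton_eq_iff eq_commute)
    moreover have "{j. j < d \<and> f v j \<noteq> f w j} = (supp (f v) - supp (f w)) \<union> (supp (f w) - supp (f v))"
    proof -
      have "f v j \<in> {0, 1}" "f w j \<in> {0, 1}" if "j < d" for j
        using layer in_H that by (auto simp: cube_verts_def PiE_iff)
      then show ?thesis
        by (fastforce simp: supp_def)
    qed
    ultimately show ?thesis
      unfolding \<phi>_def using u supp by (intro dist_subset_sums_eq_1[of d]) auto
  qed
  ultimately have "is_copy H (\<phi> ` verts H)"
    unfolding is_copy_def by blast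
  moreover have "c constant_on (\<phi> ` verts H)"
    using mono supp layer by (auto simp: constant_on_def \<phi>_def)
  ultimately show thesis
    using that by blast
qed

lemma is_copy_complete_graph_2:
  "is_copy (complete_graph 2) S \<longleftrightarrow> (\<exists>a b. S = {a, b} \<and> dist a b = 1)"
proof
  assume "is_copy (complete_graph 2) S"
  then obtain f where "bij_betw f {..<2::nat} S"
    and f: "\<And>u v. {u, v} \<in> edges (complete_graph 2) \<Longrightarrow> dist (f u) (f v) = 1"
    by (auto simp: is_copy_def complete_graph_def)
  then have "S = {f 0, f 1}"
    by (auto simp: bij_betw_def lessThan_Suc numeral_2_eq_2)
  moreover have "dist (f 0) (f 1) = 1"
    by (rule f) (auto simp: complete_graph_def)
  ultimately show "\<exists>a b. S = {a, b} \<and> dist a b = 1"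
    by blast
next
  assume "\<exists>a b. S = {a, b} \<and> dist a b = 1"
  then obtain a b where ab: "S = {a, b}" "dist a b = 1"
    by blast
  let ?f = "\<lambda>j::nat. if j = 0 then a else b"
  have "a \<noteq> b"
    using ab by auto
  then have "bij_betw ?f {..<2} S"
    by (auto simp: bij_betw_def inj_on_def ab less_2_cases_iff)
  moreover have "dist (?f u) (?f v) = 1" if "{u, v} \<in> edges (complete_graph 2)" for u v
  proof -
    have "u \<noteq> v" "u < 2" "v < 2"
      using that by (auto simp: complete_graph_def)
    then show ?thesis
      using ab by (auto simp: less_2_cases_iff dist_commute)
  qed
  ultimately show "is_copy (complete_graph 2) S"
    unfolding is_copy_def by (intro exI[of _ ?f]) (simp add: complete_graph_def)
qed

lemma avoids_mono_complete_graph_2: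
  "avoids_mono (complete_graph 2) k c \<longleftrightarrow> (\<forall>p. c p < k) \<and> (\<forall>a b. dist a b = 1 \<longrightarrow> c a \<noteq> c b)"
  by (auto simp: avoids_mono_def is_copy_complete_graph_2 constant_on_def) metis

theorem corollary1:
  fixes H :: "'v ugraph"
  assumes "simple_graph H"
    and "layered H"
    and "edges H \<noteq> {}"
    and "CARD('n::finite) \<ge> 2"
  shows "chi_copy H TYPE('n) = chi_space TYPE('n)"
proof -
  have "(\<exists>c :: real ^ 'n \<Rightarrow> nat. avoids_mono H k c) \<longleftrightarrow>
    (\<exists>c :: real ^ 'n \<Rightarrow> nat. avoids_mono (complete_graph 2) k c)" for k
  proof
    assume "\<exists>c :: real ^ 'n \<Rightarrow> nat. avoids_mono H k c"
    then obtain c :: "real ^ 'n \<Rightarrow> nat" where c: "avoids_mono H k c" ..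
    show "\<exists>c :: real ^ 'n \<Rightarrow> nat. avoids_mono (complete_graph 2) k c"
    proof (rule ccontr)
      assume no: "\<not> ?thesis"
      then have unit_pair: "\<forall>f :: real ^ 'n \<Rightarrow> nat. (\<forall>p. f p < k) \<longrightarrow> (\<exists>a b. dist a b = 1 \<and> f a = f b)"
        unfolding avoids_mono_complete_graph_2 by blast
      have "c p < k" for p
        using c by (auto simp: avoids_mono_def)
      then obtain S where "is_copy H S" "c constant_on S"
        by (rule monochromatic_layered_copy[OF assms(1,2,4) _ unit_pair]) (rule that)
      with c show False
        by (auto simp: avoids_mono_def)
    qed
  next
    assume "\<exists>c :: real ^ 'n \<Rightarrow> nat. avoids_mono (complete_graph 2) k c"
    then obtain c :: "real ^ 'n \<Rightarrow> nat"
      where c: "\<And>p. c p < k" "\<And>a b. dist a b = 1 \<Longrightarrow> c a \<noteq> c b"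
      unfolding avoids_mono_complete_graph_2 by blast
    obtain E where E: "E \<in> edges H"
      using assms(3) by blast
    then have "E \<subseteq> verts H" "card E = 2"
      using assms(1) by (auto simp: simple_graph_def)
    then obtain v w where vw: "{v, w} \<in> edges H" "v \<in> verts H" "w \<in> verts H"
      using E by (auto simp: card_2_iff)
    have "\<not> c constant_on S" if copy: "is_copy H S" for S
    proof
      assume const: "c constant_on S"
      obtain f where "bij_betw f (verts H) S" "\<forall>u v. {u, v} \<in> edges H \<longrightarrow> dist (f u) (f v) = 1"
        using copy unfolding is_copy_def by blast
      with vw(1) have "bij_betw f (verts H) S" "dist (f v) (f w) = 1"
        by simp_all
      moreover from this have "f v \<in> S" "f w \<in> S"
        using vw by (auto simp: bij_betw_def)
      moreover from this const have "c (f v) = c (f w)"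
        by (auto simp: constant_on_def)
      ultimately show False
        using c(2) by blast
    qed
    with c(1) show "\<exists>c :: real ^ 'n \<Rightarrow> nat. avoids_mono H k c"
      by (auto simp: avoids_mono_def)
  qed
  then show ?thesis
    by (simp add: chi_copy_def chi_space_def)
qed

end
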